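(* Let $n\ge 1$ be an integer and let $S_n=\{X_0,\dots,X_{n-1}\}$ where $X_j=(2^{i-j/n})_{i\in\mathbb{Z}}$. Then every schedule in $S_n$ is 4-robust, and for every probability distribution $\mu$ on $(0,+\infty)$ there exists $j^*\in\{0,\dots,n-1\}$ such that $c(X_{j^*},\mu)\le 4n\,(2^{1/n}-1)$.
   Context: A (contract) schedule is an increasing bi-infinite sequence $X=(x_i)_{i\in\mathbb{Z}}$ of positive reals with $\sum_{j\le i}x_j<\infty$; contracts are executed consecutively and contract $i$ completes at time $\sum_{j\le i}x_j$. For $T>0$, $\ell(X,T)$ is the largest length $x_i$ of a contract completed by time $T$. The robustness of $X$ is $\sup_{T>0}T/\ell(X,T)$; $X$ is $r$-robust if this is at most $r$. Given a probability distribution $\mu$ on $(0,\infty)$ (the distributional prediction of the interruption time), the consistency of $X$ is $c(X,\mu)=\mathbb{E}_{z\sim\mu}[z]\,/\,\mathbb{E}_{z\sim\mu}[\ell(X,z)]$. *)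

theory Defs
  imports "HOL-Probability.Probability"
begin

definition schedule :: "(int \<Rightarrow> real) \<Rightarrow> bool" where
  "schedule X \<longleftrightarrow> strict_mono X \<and> (\<forall>i. 0 < X i) \<and> (\<forall>i. X summable_on {..i})"

definition completion_time :: "(int \<Rightarrow> real) \<Rightarrow> int \<Rightarrow> real" where
  "completion_time X i = (\<Sum>\<^sub>\<infinity>j\<in>{..i}. X j)"

text \<open>For a schedule and \<open>T > 0\<close> the greatest element below exists: completion times tend to
  \<open>0\<close> as \<open>i\<close> tends to minus infinity and to infinity as \<open>i\<close> tends to infinity.\<close>

definition ell :: "(int \<Rightarrow> real) \<Rightarrow> real \<Rightarrow> real" where
  "ell X T = (GREATEST x. \<exists>i. x = X i \<and> completion_time X i \<le> T)"

definition robustness :: "(int \<Rightarrow> real) \<Rightarrow> ereal" where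
  "robustness X = (SUP T\<in>{0<..}. ereal (T / ell X T))"

definition robust :: "real \<Rightarrow> (int \<Rightarrow> real) \<Rightarrow> bool" where
  "robust r X \<longleftrightarrow> robustness X \<le> ereal r"

text \<open>Expectations are taken in the extended nonnegative reals, so no integrability is
  presupposed.  If both expectations are infinite, the quotient is \<open>0\<close> by the convention for
  division on this type; if the mean of \<open>\<mu>\<close> is finite and \<open>X\<close> is a schedule, both
  expectations are positive and finite and this is the ordinary quotient.\<close>

definition consistency :: "(int \<Rightarrow> real) \<Rightarrow> real measure \<Rightarrow> ennreal" where
  "consistency X \<mu> = (\<integral>\<^sup>+ z. ennreal z \<partial>\<mu>) / (\<integral>\<^sup>+ z. ennreal (ell X z) \<partial>\<mu>)"

definition shifted_doubling :: "nat \<Rightarrow> nat \<Rightarrow> int \<Rightarrow> real" where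
  "shifted_doubling n j i = 2 powr (real_of_int i - real j / real n)"

definition doubling_family :: "nat \<Rightarrow> (int \<Rightarrow> real) set" where
  "doubling_family n = {shifted_doubling n j |j. j < n}"

end

theory Submission imports Defs begin

text \<open>Contract \<open>i\<close> of the schedule with lengths \<open>2 powr (i - c)\<close> completes at time
  \<open>2 * 2 powr (i - c)\<close>. Hence, with \<open>t = log 2 T - 1\<close>, the longest contract completed by time
  \<open>T\<close> has length \<open>2 powr (\<lfloor>t + c\<rfloor> - c)\<close>, which exceeds \<open>T / 4\<close>. For \<open>c = j/n\<close> and
  \<open>m = \<lfloor>n t\<rfloor>\<close> the exponent is \<open>(m - (m + j) mod n) / n\<close>. As \<open>j\<close> runs through
  \<open>0, \<dots>, n - 1\<close> so does \<open>(m + j) mod n\<close>, so the \<open>n\<close> lengths form a geometric progression,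
  whose sum is at least \<open>T / (4 (2 powr (1/n) - 1))\<close>. Taking expectations, the best of the \<open>n\<close>
  schedules is at least as good as their average.\<close>

text \<open>Substituting \<open>k = i - int m\<close> turns the sum over all
  \<open>k \<le> i\<close> into a geometric series of ratio 1/2, whose value is twice its leading
  term.\<close>

lemma powr_two_has_sum:
  fixes c :: real and i :: int
  shows "((\<lambda>k. 2 powr (real_of_int k - c)) has_sum 2 * 2 powr (real_of_int i - c)) {..i}"
proof -
  define a where "a = 2 powr (real_of_int i - c)"
  have "(\<lambda>m. (1/2::real) ^ m) sums 2"
    using geometric_sums[of "1/2::real"] by simp
  then have "(\<lambda>m. a * (1/2) ^ m) sums (a * 2)"
    by (rule sums_mult)
  then have "((\<lambda>m. a * (1/2) ^ m) has_sum (2 * a)) (UNIV :: nat set)"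
    by (intro norm_summable_imp_has_sum) (auto simp: a_def abs_mult power_abs mult.commute sums_iff)
  moreover have "2 powr (real_of_int (i - int m) - c) = a * (1/2) ^ m" for m
  proof -
    have "2 powr (real_of_int (i - int m) - c) = 2 powr (real_of_int i - c) * 2 powr (- real m)"
      by (simp add: powr_add[symmetric] algebra_simps)
    then show ?thesis
      by (simp add: a_def powr_minus powr_realpow power_one_over inverse_eq_divide)
  qed
  ultimately have "((\<lambda>k. 2 powr (real_of_int k - c)) \<circ> (\<lambda>m. i - int m) has_sum 2 * a) UNIV"
    by (simp add: o_def)
  moreover have "range (\<lambda>m. i - int m) = {..i}"
  proof -
    have "k \<in> range (\<lambda>m. i - int m)" if "k \<le> i" for k
      using that by (intro image_eqI[of _ _ "nat (i - k)"]) auto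
    then show ?thesis by auto
  qed
  moreover have "inj (\<lambda>m. i - int m)"
    by (auto simp: inj_on_def)
  ultimately show ?thesis
    using has_sum_reindex[of "\<lambda>m. i - int m" UNIV "\<lambda>k. 2 powr (real_of_int k - c)"]
    by (simp add: a_def)
qed

lemma schedule_shifted_doubling: "schedule (shifted_doubling n j)"
  unfolding schedule_def
proof (intro conjI allI)
  show "strict_mono (shifted_doubling n j)"
    by (auto simp: strict_mono_def shifted_doubling_def)
  show "shifted_doubling n j summable_on {..i}" for i
    using powr_two_has_sum[of "real j / real n" i]
    by (auto simp: summable_on_def shifted_doubling_def[abs_def])
qed (auto simp: shifted_doubling_def)

lemma completion_time_shifted_doubling:
  "completion_time (shifted_doubling n j) i = 2 * shifted_doubling n j i"
  using powr_two_has_sum[of "real j / real n" i]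
  by (auto simp: completion_time_def shifted_doubling_def[abs_def] intro: infsumI)

text \<open>Completion at twice the length makes "completed by \<open>T\<close>" an upper bound on
  the index, whose integer solutions end at the floor. Lengths increase with the index, so the last
  completed contract is the longest.\<close>

lemma ell_shifted_doubling:
  assumes "0 < T"
  shows "ell (shifted_doubling n j) T =
    shifted_doubling n j \<lfloor>log 2 T - 1 + real j / real n\<rfloor>"
proof -
  have completed: "completion_time (shifted_doubling n j) i \<le> T \<longleftrightarrow>
      i \<le> \<lfloor>log 2 T - 1 + real j / real n\<rfloor>" for i
  proof -
    have "completion_time (shifted_doubling n j) i = 2 powr (real_of_int i - real j / real n + 1)"
      by (simp add: completion_time_shifted_doubling shifted_doubling_def powr_add)
    also have "\<dots> \<le> T \<longleftrightarrow> real_of_int i - real j / real n + 1 \<le> log 2 T"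
      using assms by (simp add: le_log_iff)
    finally show ?thesis by (auto simp: le_floor_iff)
  qed
  show ?thesis
    unfolding ell_def
    by (rule Greatest_equality) (auto simp: completed shifted_doubling_def)
qed

lemma shifted_doubling_robust: "robust 4 (shifted_doubling n j)"
  unfolding robust_def robustness_def
proof (rule SUP_least)
  fix T :: real
  assume "T \<in> {0<..}"
  then have T: "0 < T" by simp
  define k where "k = \<lfloor>log 2 T - 1 + real j / real n\<rfloor>"
  \<comment> \<open>The 2 is the shift by 1 inside the floor plus a rounding loss of less than 1;
    exponentiated, it is the robustness factor 4.\<close>
  have "log 2 T \<le> real_of_int k - real j / real n + 2"
    unfolding k_def by linarith
  then have "T \<le> 2 powr (real_of_int k - real j / real n + 2)"
    using T by (simp add: log_le_iff)
  also have "\<dots> = 4 * shifted_doubling n j k"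
    by (simp add: shifted_doubling_def powr_add)
  finally have "T \<le> 4 * shifted_doubling n j k" .
  moreover have "0 < shifted_doubling n j k"
    by (simp add: shifted_doubling_def)
  ultimately show "ereal (T / ell (shifted_doubling n j) T) \<le> ereal 4"
    by (simp add: ell_shifted_doubling[OF T] k_def[symmetric] divide_le_eq)
qed

text \<open>A cyclic shift permutes the residues modulo \<open>n\<close>: it is an injection of a
  finite set into itself. Also for negative \<open>m\<close> the remainder lies in
  \<open>{0..<n}\<close>, so \<open>nat\<close> loses nothing.\<close>

lemma sum_mod_shift:
  fixes f :: "int \<Rightarrow> real" and m :: int
  assumes "n \<ge> 1"
  shows "(\<Sum>j<n. f ((m + int j) mod int n)) = (\<Sum>r<n. f (int r))"
proof -
  let ?g = "\<lambda>j. nat ((m + int j) mod int n)"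
  have inj: "inj_on ?g {..<n}"
  proof (rule inj_onI)
    fix a b assume ab: "a \<in> {..<n}" "b \<in> {..<n}" "?g a = ?g b"
    then have "(m + int a) mod int n = (m + int b) mod int n"
      using assms by (simp add: eq_nat_nat_iff)
    \<comment> \<open>Congruent numbers that differ by less than \<open>n\<close> are equal.\<close>
    then have "int n dvd (int a - int b)"
      by (simp add: mod_eq_dvd_iff)
    moreover have "\<bar>int a - int b\<bar> < int n"
      using ab by auto
    ultimately show "a = b"
      using zdvd_imp_le[of "int n" "\<bar>int a - int b\<bar>"] by force
  qed
  have "?g ` {..<n} = {..<n}"
    using assms by (intro endo_inj_surj inj) (auto simp: nat_less_iff)
  then have "(\<Sum>r<n. f (int r)) = (\<Sum>j<n. f (int (?g j)))"
    using sum.reindex[OF inj, of "\<lambda>r. f (int r)"] by (simp add: o_def)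
  then show ?thesis
    using assms by simp
qed

lemma sum_ell_shifted_doubling_ge:
  assumes n: "n \<ge> 1" and T: "0 < T"
  shows "T \<le> 4 * (2 powr (1 / real n) - 1) * (\<Sum>j<n. ell (shifted_doubling n j) T)"
proof -
  define t where "t = log 2 T - 1"
  define m where "m = \<lfloor>real n * t\<rfloor>"
  define q where "q = 2 powr (1 / real n)"
  have q: "q > 1"
    using n by (simp add: q_def)
  have qn: "q ^ n = 2"
    using n by (simp add: q_def powr_realpow[symmetric] powr_powr)
  have ell: "ell (shifted_doubling n j) T =
      2 powr (m / n) * 2 powr (- real_of_int ((m + int j) mod int n) / n)" for j
  proof -
    have "\<lfloor>t + real j / real n\<rfloor> = \<lfloor>(real n * t + real j) / real n\<rfloor>"
      using n by (simp add: add_divide_distrib)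
    \<comment> \<open>Rounding down before dividing by a positive integer does not change the floor
      of the quotient, so only \<open>m\<close> matters and not the fractional part of
      \<open>real n * t\<close>.\<close>
    also have "\<dots> = \<lfloor>real n * t + real j\<rfloor> div int n"
      using floor_divide_real_eq_div[of "int n" "real n * t + real j"] by simp
    also have "\<lfloor>real n * t + real j\<rfloor> = m + int j"
      by (simp add: m_def)
    finally have fl: "\<lfloor>t + real j / real n\<rfloor> = (m + int j) div int n" .
    have "real_of_int (m + int j) =
        real n * real_of_int ((m + int j) div int n) + real_of_int ((m + int j) mod int n)"
      by (metis mult_div_mod_eq of_int_add of_int_mult of_int_of_nat_eq)
    then have "real_of_int ((m + int j) div int n) - real j / real n =
        m / n + - real_of_int ((m + int j) mod int n) / n"
      using n by (simp add: field_simps)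
    then show ?thesis
      using fl T
      by (simp add: ell_shifted_doubling shifted_doubling_def t_def powr_add[symmetric])
  qed
  have "(\<Sum>j<n. ell (shifted_doubling n j) T) =
      2 powr (m / n) * (\<Sum>r<n. 2 powr (- real r / n))"
    unfolding ell sum_distrib_left[symmetric]
    using sum_mod_shift[OF n, of "\<lambda>r. 2 powr (- real_of_int r / n)" m] by simp
  also have "(\<Sum>r<n. 2 powr (- real r / n)) = (\<Sum>r<n. (1 / q) ^ r)"
    by (rule sum.cong)
      (auto simp: q_def powr_realpow[symmetric] powr_powr powr_minus power_one_over inverse_eq_divide)
  also have "\<dots> = (1 - (1 / q) ^ n) / (1 - 1 / q)"
    using q by (simp add: sum_gp_strict)
  \<comment> \<open>By \<open>qn\<close> the numerator is 1 - 1/2.\<close>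
  also have "\<dots> = q / (2 * (q - 1))"
    using q qn by (simp add: power_one_over field_simps)
  finally have "4 * (q - 1) * (\<Sum>j<n. ell (shifted_doubling n j) T) = 2 * (2 powr (m / n) * q)"
    using q by (simp add: field_simps)
  also have "\<dots> = 2 powr (1 + (m + 1) / n)"
    by (simp add: q_def powr_add add_divide_distrib)
  finally have sum: "4 * (q - 1) * (\<Sum>j<n. ell (shifted_doubling n j) T) =
    2 powr (1 + (m + 1) / n)" .
  \<comment> \<open>The factor \<open>q\<close> left by the geometric sum raises the exponent from
    \<open>m / n\<close> to \<open>(m + 1) / n\<close>, which is what makes up for the rounding in
    \<open>m\<close>.\<close>
  have "real n * t \<le> m + 1"
    unfolding m_def by linarith
  then have "t \<le> (m + 1) / n"
    using n by (simp add: field_simps)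
  then have "T \<le> 2 powr (1 + (m + 1) / n)"
    using T by (subst log_le_iff[symmetric]) (auto simp: t_def)
  then show ?thesis
    using sum by (simp add: q_def)
qed

lemma ell_shifted_doubling_measurable:
  assumes "sets \<mu> = sets (restrict_space borel {0<..})"
  shows "ell (shifted_doubling n j) \<in> borel_measurable \<mu>"
proof -
  have "ell (shifted_doubling n j) \<in> borel_measurable (restrict_space borel {0<..})"
  \<comment> \<open>The \<open>GREATEST\<close> in \<open>ell\<close> gives no direct access to
    measurability; on positive arguments it is replaced by the closed form, a composition of Borel
    functions.\<close>
  proof (subst measurable_cong)
    show "ell (shifted_doubling n j) T =
        2 powr (real_of_int \<lfloor>log 2 T - 1 + real j / real n\<rfloor> - real j / real n)"
      if "T \<in> space (restrict_space borel {0<..})" for T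
      using that by (simp add: space_restrict_space ell_shifted_doubling shifted_doubling_def)
    show "(\<lambda>T. 2 powr (real_of_int \<lfloor>log 2 T - 1 + real j / real n\<rfloor> - real j / real n))
        \<in> borel_measurable (restrict_space borel {0<..})"
      by (rule measurable_restrict_space1) measurable
  qed
  then show ?thesis
    by (simp add: measurable_cong_sets[OF assms refl])
qed

text \<open>The pointwise bound is integrated over \<open>\<mu>\<close>. Nonnegative integrals are
  additive even when infinite, so an infinite mean needs no separate treatment.\<close>

lemma mean_le_sum_expected_ell:
  assumes n: "n \<ge> 1" and sets: "sets \<mu> = sets (restrict_space borel {0<..})"
  shows "(\<integral>\<^sup>+ z. ennreal z \<partial>\<mu>) \<le> ennreal (4 * (2 powr (1 / real n) - 1)) *
    (\<Sum>j<n. \<integral>\<^sup>+ z. ennreal (ell (shifted_doubling n j) z) \<partial>\<mu>)"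
proof -
  define d where "d = 4 * (2 powr (1 / real n) - 1)"
  have d: "d \<ge> 0"
    using ge_one_powr_ge_zero[of 2 "1 / real n"] by (simp add: d_def)
  note [measurable] = ell_shifted_doubling_measurable[OF sets]
  have "(\<integral>\<^sup>+ z. ennreal z \<partial>\<mu>) \<le>
      (\<integral>\<^sup>+ z. ennreal d * (\<Sum>j<n. ennreal (ell (shifted_doubling n j) z)) \<partial>\<mu>)"
  proof (rule nn_integral_mono)
    fix z assume "z \<in> space \<mu>"
    then have z: "0 < z"
      using sets_eq_imp_space_eq[OF sets] by (simp add: space_restrict_space)
    have "ell (shifted_doubling n j) z \<ge> 0" for j
      using z by (simp add: ell_shifted_doubling shifted_doubling_def)
    then have "ennreal d * (\<Sum>j<n. ennreal (ell (shifted_doubling n j) z)) =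
        ennreal (d * (\<Sum>j<n. ell (shifted_doubling n j) z))"
      using d by (simp add: sum_nonneg ennreal_mult)
    then show "ennreal z \<le> ennreal d * (\<Sum>j<n. ennreal (ell (shifted_doubling n j) z))"
      using sum_ell_shifted_doubling_ge[OF n z] by (auto simp: d_def intro: ennreal_leI)
  qed
  also have "\<dots> = ennreal d * (\<Sum>j<n. \<integral>\<^sup>+ z. ennreal (ell (shifted_doubling n j) z) \<partial>\<mu>)"
    by (simp add: nn_integral_cmult nn_integral_sum)
  finally show ?thesis
    by (simp add: d_def)
qed

text \<open>The degenerate divisors agree with the conventions: \<open>b = 0\<close> forces
  \<open>a = 0\<close>, and then the quotient is 0; for \<open>b = \<top>\<close> the quotient is 0
  for every \<open>a\<close>.\<close>

lemma ennreal_divide_le_of_le_mult: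
  fixes a b c :: ennreal
  assumes "a \<le> c * b"
  shows "a / b \<le> c"
proof (cases "b = 0 \<or> b = \<top>")
  case True
  then show ?thesis
    using assms by auto
next
  case False
  have "a / b \<le> c * b / b"
    using assms by (rule divide_right_mono_ennreal)
  also have "\<dots> = c"
    using False by (simp add: ennreal_mult_divide_eq)
  finally show ?thesis .
qed

theorem theorem1:
  fixes n :: nat
  assumes "n \<ge> 1"
  shows "(\<forall>X\<in>doubling_family n. schedule X \<and> robust 4 X) \<and>
    (\<forall>\<mu> :: real measure.
       prob_space \<mu> \<and> sets \<mu> = sets (restrict_space borel {0<..}) \<longrightarrow>
       (\<exists>j\<in>{0..<n}. consistency (shifted_doubling n j) \<mu>
           \<le> ennreal (4 * real n * (2 powr (1 / real n) - 1))))"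
proof (intro conjI allI impI)
  show "\<forall>X\<in>doubling_family n. schedule X \<and> robust 4 X"
    by (auto simp: doubling_family_def schedule_shifted_doubling shifted_doubling_robust)
next
  fix \<mu> :: "real measure"
  assume "prob_space \<mu> \<and> sets \<mu> = sets (restrict_space borel {0<..})"
  then have sets: "sets \<mu> = sets (restrict_space borel {0<..})" by simp
  define d where "d = 4 * (2 powr (1 / real n) - 1)"
  have d: "d \<ge> 0"
    using ge_one_powr_ge_zero[of 2 "1 / real n"] by (simp add: d_def)
  define e where "e j = (\<integral>\<^sup>+ z. ennreal (ell (shifted_doubling n j) z) \<partial>\<mu>)" for j
  \<comment> \<open>The schedule is chosen to maximize the expected length, since the numerator of
    the consistency is common to all; the sum is then at most \<open>n\<close> times this
    maximum.\<close>
  have "Max (e ` {..<n}) \<in> e ` {..<n}"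
    using assms by (intro Max_in) (auto simp: lessThan_empty_iff)
  then obtain j where j: "j < n" "e j = Max (e ` {..<n})"
    by auto
  have "(\<integral>\<^sup>+ z. ennreal z \<partial>\<mu>) \<le> ennreal d * (\<Sum>i<n. e i)"
    using mean_le_sum_expected_ell[OF assms sets] by (simp add: d_def e_def)
  also have "\<dots> \<le> ennreal d * (\<Sum>i<n. e j)"
    using j by (intro mult_left_mono sum_mono) auto
  also have "\<dots> = ennreal (d * real n) * e j"
    using d by (simp add: ennreal_mult ennreal_of_nat_eq_real_of_nat mult.assoc)
  finally have "consistency (shifted_doubling n j) \<mu> \<le> ennreal (d * real n)"
    unfolding consistency_def e_def by (rule ennreal_divide_le_of_le_mult)
  then show "\<exists>j\<in>{0..<n}. consistency (shifted_doubling n j) \<mu>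
      \<le> ennreal (4 * real n * (2 powr (1 / real n) - 1))"
    using j by (intro bexI[of _ j]) (auto simp: d_def mult_ac)
qed

end
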